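(* Let $G$ be a finite group, $k$ a ring, and let $\omega:G^3\to k$ be a 3-cocycle, i.e. a map such that for all $g_1,g_2,g_3,g_4\in G$: 1. $\omega(g_1,g_2,g_3)+\omega(g_1^{-1},g_1g_2,g_3)=0$; 2. $\omega(g_1,g_2,g_3)+\omega(g_1g_2,g_2^{-1},g_2g_3)=0$; 3. $\omega(g_1,g_2,g_3)+\omega(g_1,g_2g_3,g_3^{-1})=0$; 4. $\omega(g_2,g_3,g_4)-\omega(g_1g_2,g_3,g_4)+\omega(g_1,g_2g_3,g_4)-\omega(g_1,g_2,g_3g_4)+\omega(g_1,g_2,g_3)=0$. Let $\mathbb K$ be an (associative, unital) ring whose multiplicative group is isomorphic to the additive group of $k$, via an isomorphism $\theta:(k,+)\to\mathbb K^\times$. Let all modules $V_{a,b,c}$ ($a,b,c\in G$, $abc=1$) be one-dimensional, $V_{a,b,c}=\mathbb K$, let all isomorphisms $\mathcal I_{a,b,c}$ be trivial, meaning that $\mathcal I_{a,b,c}(1)$ is the linear map $\mathbb K\to\mathbb K$ with $1\mapsto 1$, and let $[a,b,c]$ and $\overline{[a,b,c]}$, being tensors on one-dimensional modules and hence just elements of $\mathbb K$ (their values on the tensor product of the standard generators), be the elements $\theta(\omega(a,b,c))$ and $\theta(-\omega(a,b,c))$ respectively, for all $a,b,c\in G$. Then $\mathcal S_\omega=(\{V_{a,b,c}\},\{\mathcal I_{a,b,c}\},\{[a,b,c]\},\{\overline{[a,b,c]}\})$ is a special $G$-system.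
   Context: **$G$-systems.** $\mathbb K$ is an associative ring with unit. For each $(a,b,c)\in G^3$ with $abc=1$ let $V_{a,b,c}$ be a finite-dimensional module over $\mathbb K$ (with a finite basis), where $V_{a,b,c}=V_{b,c,a}=V_{c,a,b}$ are three names for the same module, and let $\mathcal I_{a,b,c}:V_{a,b,c}\to V^*_{c^{-1},b^{-1},a^{-1}}$ be a fixed isomorphism. For each $(a,b,c)\in G^3$ let $$[a,b,c]: V_{b,c,(bc)^{-1}}\otimes V^*_{ab,c,(abc)^{-1}}\otimes V_{a,bc,(abc)^{-1}}\otimes V^*_{a,b,(ab)^{-1}}\to\mathbb K,$$ $$\overline{[a,b,c]}: V^*_{b,c,(bc)^{-1}}\otimes V_{ab,c,(abc)^{-1}}\otimes V^*_{a,bc,(abc)^{-1}}\otimes V_{a,b,(ab)^{-1}}\to\mathbb K$$ be tensors. These data form a *$G$-system* if for all $a,b,c\in G$ and all $x_0,\dots,x_3$ in the modules prescribed by the left-hand sides: 1. $\overline{[a^{-1},ab,c]}(x_0\otimes x_1\otimes x_2\otimes x_3)=[a,b,c](x_1\otimes x_0\otimes\mathcal I^{-1}_{a,bc,(abc)^{-1}}(x_2)\otimes\mathcal I_{a^{-1},ab,b^{-1}}(x_3))$; 2. $\overline{[ab,b^{-1},bc]}(x_0\otimes x_1\otimes x_2\otimes x_3)=[a,b,c](\mathcal I^{-1}_{b,c,(bc)^{-1}}(x_0)\otimes x_2\otimes x_1\otimes\mathcal I_{ab,b^{-1},a^{-1}}(x_3))$; 3. $\overline{[a,bc,c^{-1}]}(x_0\otimes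 x_1\otimes x_2\otimes x_3)=[a,b,c](\mathcal I^{-1}_{b,c,(bc)^{-1}}(x_0)\otimes\mathcal I_{abc,c^{-1},(ab)^{-1}}(x_1)\otimes x_3\otimes x_2)$. **Contraction.** For $\varphi:A\otimes B\to\mathbb K$, $\psi:A^*\otimes C\to\mathbb K$, $*_A(\varphi\otimes\psi)(b\otimes c)=\sum_i\varphi(e_i\otimes b)\cdot\psi(e^i\otimes c)$ with $\{e_i\}$ a basis of $A$ and $\{e^i\}$ the dual basis of $A^*$; similarly along several modules. **Special.** A $G$-system is *special* if for all $a,b,c,d\in G$ $$*_{V_{ab,cd,(abcd)^{-1}}}([ab,c,d]\otimes[a,b,cd])=*_{V_{b,c,(bc)^{-1}},V_{bc,d,(bcd)^{-1}},V_{a,bc,(abc)^{-1}}}([b,c,d]\otimes[a,bc,d]\otimes[a,b,c])$$ as tensors on $V_{b,cd,(bcd)^{-1}}\otimes V_{a,bcd,(abcd)^{-1}}\otimes V^*_{a,b,(ab)^{-1}}\otimes V_{c,d,(cd)^{-1}}\otimes V^*_{abc,d,(abcd)^{-1}}\otimes V^*_{ab,c,(abc)^{-1}}$. The standard generators are $1\in\mathbb K$ and $\mathrm{id}\in\mathbb K^*$.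
   Formalization: The ring 𝕂 is in effect commutative: the tensors [a,b,c] are required to be 𝕂-linear in each factor with invertible values on generators, which forces it; for noncommutative 𝕂 such tensors do not exist and the symmetry axioms fail. *)

theory Defs
  imports "HOL-Algebra.Module"
begin

definition self_module :: "('k, 'm) ring_scheme \<Rightarrow> ('k, 'k) module" where
  "self_module K = \<lparr>carrier = carrier K, mult = (\<otimes>\<^bsub>K\<^esub>), one = \<one>\<^bsub>K\<^esub>,
     zero = \<zero>\<^bsub>K\<^esub>, add = (\<oplus>\<^bsub>K\<^esub>), smult = (\<otimes>\<^bsub>K\<^esub>)\<rparr>"

definition linear_maps ::
  "('k, 'm) ring_scheme \<Rightarrow> ('k, 'v) module \<Rightarrow> ('k, 'w) module \<Rightarrow> ('v \<Rightarrow> 'w) set" where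
  "linear_maps K M N = {f \<in> carrier M \<rightarrow> carrier N.
     (\<forall>x\<in>carrier M. \<forall>y\<in>carrier M. f (x \<oplus>\<^bsub>M\<^esub> y) = f x \<oplus>\<^bsub>N\<^esub> f y) \<and>
     (\<forall>r\<in>carrier K. \<forall>x\<in>carrier M. f (r \<odot>\<^bsub>M\<^esub> x) = r \<odot>\<^bsub>N\<^esub> f x)}"

definition linear_isos ::
  "('k, 'm) ring_scheme \<Rightarrow> ('k, 'v) module \<Rightarrow> ('k, 'w) module \<Rightarrow> ('v \<Rightarrow> 'w) set" where
  "linear_isos K M N = {f \<in> linear_maps K M N. bij_betw f (carrier M) (carrier N)}"

text \<open>The components \<open>mult\<close> and \<open>one\<close> are inherited from the record type \<open>ring\<close> and play no
  role in a module.\<close>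

definition dual :: "('k, 'm) ring_scheme \<Rightarrow> ('k, 'v) module \<Rightarrow> ('k, 'v \<Rightarrow> 'k) module" where
  "dual K M = \<lparr>carrier = linear_maps K M (self_module K) \<inter> extensional (carrier M),
     mult = undefined, one = undefined,
     zero = (\<lambda>x\<in>carrier M. \<zero>\<^bsub>K\<^esub>),
     add = (\<lambda>f g. \<lambda>x\<in>carrier M. f x \<oplus>\<^bsub>K\<^esub> g x),
     smult = (\<lambda>r f. \<lambda>x\<in>carrier M. r \<otimes>\<^bsub>K\<^esub> f x)\<rparr>"

definition finite_basis :: "('k, 'm) ring_scheme \<Rightarrow> ('k, 'v) module \<Rightarrow> 'v set \<Rightarrow> bool" where
  "finite_basis K M B \<longleftrightarrow> finite B \<and> B \<subseteq> carrier M \<and>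
     (\<forall>x\<in>carrier M. \<exists>!r. r \<in> B \<rightarrow>\<^sub>E carrier K \<and> x = (\<Oplus>\<^bsub>M\<^esub>b\<in>B. r b \<odot>\<^bsub>M\<^esub> b))"

definition dual_vector ::
  "('k, 'm) ring_scheme \<Rightarrow> ('k, 'v) module \<Rightarrow> 'v set \<Rightarrow> 'v \<Rightarrow> ('v \<Rightarrow> 'k)" where
  "dual_vector K M B e = (THE f. f \<in> carrier (dual K M) \<and>
     (\<forall>b\<in>B. f b = (if b = e then \<one>\<^bsub>K\<^esub> else \<zero>\<^bsub>K\<^esub>)))"

text \<open>A linear map \<open>M\<^sub>0 \<otimes> M\<^sub>1 \<otimes> M\<^sub>2 \<otimes> M\<^sub>3 \<rightarrow> K\<close> is represented by the corresponding multilinear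
  map: \<open>\<phi> x\<^sub>0 x\<^sub>1 x\<^sub>2 x\<^sub>3\<close> is its value on \<open>x\<^sub>0 \<otimes> x\<^sub>1 \<otimes> x\<^sub>2 \<otimes> x\<^sub>3\<close>. Values outside the carriers are
  irrelevant, so equality of tensors means equality on the carriers.\<close>

definition tensors ::
  "('k, 'm) ring_scheme \<Rightarrow> ('k, 'v0) module \<Rightarrow> ('k, 'v1) module \<Rightarrow> ('k, 'v2) module \<Rightarrow>
   ('k, 'v3) module \<Rightarrow> ('v0 \<Rightarrow> 'v1 \<Rightarrow> 'v2 \<Rightarrow> 'v3 \<Rightarrow> 'k) set" where
  "tensors K M0 M1 M2 M3 = {\<phi>.
     \<forall>x0\<in>carrier M0. \<forall>x1\<in>carrier M1. \<forall>x2\<in>carrier M2. \<forall>x3\<in>carrier M3.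
       (\<lambda>x. \<phi> x x1 x2 x3) \<in> linear_maps K M0 (self_module K) \<and>
       (\<lambda>x. \<phi> x0 x x2 x3) \<in> linear_maps K M1 (self_module K) \<and>
       (\<lambda>x. \<phi> x0 x1 x x3) \<in> linear_maps K M2 (self_module K) \<and>
       (\<lambda>x. \<phi> x0 x1 x2 x) \<in> linear_maps K M3 (self_module K)}"

text \<open>Contraction \<open>\<Sum>\<^sub>i F e\<^sub>i e\<^sup>i\<close> of a form \<open>F\<close> on \<open>M \<times> M\<^sup>*\<close>. For bilinear \<open>F\<close> the result does not
  depend on the chosen basis. Contraction along several modules is iterated contraction.\<close>

definition contract ::
  "('k, 'm) ring_scheme \<Rightarrow> ('k, 'v) module \<Rightarrow> ('v \<Rightarrow> ('v \<Rightarrow> 'k) \<Rightarrow> 'k) \<Rightarrow> 'k" where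
  "contract K M F = (let B = (SOME B. finite_basis K M B)
     in \<Oplus>\<^bsub>K\<^esub>e\<in>B. F e (dual_vector K M B e))"

text \<open>\<open>V a b c\<close> and \<open>\<I> a b c\<close> matter only for \<open>a b c = 1\<close>; \<open>br a b c\<close> and \<open>brb a b c\<close> stand for
  \<open>[a,b,c]\<close> and its barred version.\<close>

locale G_data = G: group G + K: ring K
  for G :: "('g, 'n) monoid_scheme" (structure) and K :: "('k, 'm) ring_scheme" +
  fixes V :: "'g \<Rightarrow> 'g \<Rightarrow> 'g \<Rightarrow> ('k, 'v) module"
    and \<I> :: "'g \<Rightarrow> 'g \<Rightarrow> 'g \<Rightarrow> 'v \<Rightarrow> ('v \<Rightarrow> 'k)"
    and br :: "'g \<Rightarrow> 'g \<Rightarrow> 'g \<Rightarrow> 'v \<Rightarrow> ('v \<Rightarrow> 'k) \<Rightarrow> 'v \<Rightarrow> ('v \<Rightarrow> 'k) \<Rightarrow> 'k"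
    and brb :: "'g \<Rightarrow> 'g \<Rightarrow> 'g \<Rightarrow> ('v \<Rightarrow> 'k) \<Rightarrow> 'v \<Rightarrow> ('v \<Rightarrow> 'k) \<Rightarrow> 'v \<Rightarrow> 'k"
begin

abbreviation W :: "'g \<Rightarrow> 'g \<Rightarrow> ('k, 'v) module" where
  "W a b \<equiv> V a b (inv (a \<otimes> b))"

abbreviation W_dual :: "'g \<Rightarrow> 'g \<Rightarrow> ('k, 'v \<Rightarrow> 'k) module" where
  "W_dual a b \<equiv> dual K (W a b)"

abbreviation \<I>_inv :: "'g \<Rightarrow> 'g \<Rightarrow> 'g \<Rightarrow> ('v \<Rightarrow> 'k) \<Rightarrow> 'v" where
  "\<I>_inv a b c \<equiv> inv_into (carrier (V a b c)) (\<I> a b c)"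

end

text \<open>The library's \<open>module\<close> locale entails commutativity of \<open>K\<close>, without which there are no
  \<open>K\<close>-linear tensor products or isomorphisms from a module to a dual module.\<close>

locale G_system = G_data +
  assumes module_V: "\<lbrakk>a \<in> carrier G; b \<in> carrier G; c \<in> carrier G; a \<otimes> b \<otimes> c = \<one>\<rbrakk>
      \<Longrightarrow> module K (V a b c)"
    and finite_dim_V: "\<lbrakk>a \<in> carrier G; b \<in> carrier G; c \<in> carrier G; a \<otimes> b \<otimes> c = \<one>\<rbrakk>
      \<Longrightarrow> \<exists>B. finite_basis K (V a b c) B"
    and cyclic_V: "\<lbrakk>a \<in> carrier G; b \<in> carrier G; c \<in> carrier G; a \<otimes> b \<otimes> c = \<one>\<rbrakk>
      \<Longrightarrow> V a b c = V b c a \<and> V b c a = V c a b"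
    and iso_\<I>: "\<lbrakk>a \<in> carrier G; b \<in> carrier G; c \<in> carrier G; a \<otimes> b \<otimes> c = \<one>\<rbrakk>
      \<Longrightarrow> \<I> a b c \<in> linear_isos K (V a b c) (dual K (V (inv c) (inv b) (inv a)))"
    and tensor_br: "\<lbrakk>a \<in> carrier G; b \<in> carrier G; c \<in> carrier G\<rbrakk>
      \<Longrightarrow> br a b c \<in> tensors K (W b c) (W_dual (a \<otimes> b) c) (W a (b \<otimes> c)) (W_dual a b)"
    and tensor_brb: "\<lbrakk>a \<in> carrier G; b \<in> carrier G; c \<in> carrier G\<rbrakk>
      \<Longrightarrow> brb a b c \<in> tensors K (W_dual b c) (W (a \<otimes> b) c) (W_dual a (b \<otimes> c)) (W a b)"
    and symmetry_1: "\<lbrakk>a \<in> carrier G; b \<in> carrier G; c \<in> carrier G;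
        x0 \<in> carrier (W_dual (a \<otimes> b) c); x1 \<in> carrier (W b c);
        x2 \<in> carrier (W_dual (inv a) (a \<otimes> b \<otimes> c)); x3 \<in> carrier (W (inv a) (a \<otimes> b))\<rbrakk>
      \<Longrightarrow> brb (inv a) (a \<otimes> b) c x0 x1 x2 x3 =
        br a b c x1 x0 (\<I>_inv a (b \<otimes> c) (inv (a \<otimes> b \<otimes> c)) x2) (\<I> (inv a) (a \<otimes> b) (inv b) x3)"
    and symmetry_2: "\<lbrakk>a \<in> carrier G; b \<in> carrier G; c \<in> carrier G;
        x0 \<in> carrier (W_dual (inv b) (b \<otimes> c)); x1 \<in> carrier (W a (b \<otimes> c));
        x2 \<in> carrier (W_dual (a \<otimes> b) c); x3 \<in> carrier (W (a \<otimes> b) (inv b))\<rbrakk>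
      \<Longrightarrow> brb (a \<otimes> b) (inv b) (b \<otimes> c) x0 x1 x2 x3 =
        br a b c (\<I>_inv b c (inv (b \<otimes> c)) x0) x2 x1 (\<I> (a \<otimes> b) (inv b) (inv a) x3)"
    and symmetry_3: "\<lbrakk>a \<in> carrier G; b \<in> carrier G; c \<in> carrier G;
        x0 \<in> carrier (W_dual (b \<otimes> c) (inv c)); x1 \<in> carrier (W (a \<otimes> b \<otimes> c) (inv c));
        x2 \<in> carrier (W_dual a b); x3 \<in> carrier (W a (b \<otimes> c))\<rbrakk>
      \<Longrightarrow> brb a (b \<otimes> c) (inv c) x0 x1 x2 x3 =
        br a b c (\<I>_inv b c (inv (b \<otimes> c)) x0) (\<I> (a \<otimes> b \<otimes> c) (inv c) (inv (a \<otimes> b)) x1) x3 x2"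

text \<open>In the equation below \<open>e\<close> and \<open>e'\<close>, and likewise the other pairs, are the arguments that are
  contracted with each other.\<close>

locale special_G_system = G_system +
  assumes special: "\<lbrakk>a \<in> carrier G; b \<in> carrier G; c \<in> carrier G; d \<in> carrier G;
        u1 \<in> carrier (W b (c \<otimes> d)); u2 \<in> carrier (W a (b \<otimes> c \<otimes> d)); u3 \<in> carrier (W_dual a b);
        u4 \<in> carrier (W c d); u5 \<in> carrier (W_dual (a \<otimes> b \<otimes> c) d);
        u6 \<in> carrier (W_dual (a \<otimes> b) c)\<rbrakk>
      \<Longrightarrow> contract K (W (a \<otimes> b) (c \<otimes> d)) (\<lambda>e e'.
            br (a \<otimes> b) c d u4 u5 e u6 \<otimes>\<^bsub>K\<^esub> br a b (c \<otimes> d) u1 e' u2 u3) =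
          contract K (W b c) (\<lambda>e e'. contract K (W (b \<otimes> c) d) (\<lambda>f f'.
            contract K (W a (b \<otimes> c)) (\<lambda>g g'.
              br b c d u4 f' u1 e' \<otimes>\<^bsub>K\<^esub> br a (b \<otimes> c) d f u5 u2 g' \<otimes>\<^bsub>K\<^esub> br a b c e u6 g u3)))"

definition cocycle3 ::
  "('g, 'n) monoid_scheme \<Rightarrow> ('r, 'm) ring_scheme \<Rightarrow> ('g \<Rightarrow> 'g \<Rightarrow> 'g \<Rightarrow> 'r) \<Rightarrow> bool" where
  "cocycle3 G R \<omega> \<longleftrightarrow>
     (\<forall>g1\<in>carrier G. \<forall>g2\<in>carrier G. \<forall>g3\<in>carrier G. \<omega> g1 g2 g3 \<in> carrier R) \<and>
     (\<forall>g1\<in>carrier G. \<forall>g2\<in>carrier G. \<forall>g3\<in>carrier G. \<forall>g4\<in>carrier G.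
        \<omega> g1 g2 g3 \<oplus>\<^bsub>R\<^esub> \<omega> (inv\<^bsub>G\<^esub> g1) (g1 \<otimes>\<^bsub>G\<^esub> g2) g3 = \<zero>\<^bsub>R\<^esub> \<and>
        \<omega> g1 g2 g3 \<oplus>\<^bsub>R\<^esub> \<omega> (g1 \<otimes>\<^bsub>G\<^esub> g2) (inv\<^bsub>G\<^esub> g2) (g2 \<otimes>\<^bsub>G\<^esub> g3) = \<zero>\<^bsub>R\<^esub> \<and>
        \<omega> g1 g2 g3 \<oplus>\<^bsub>R\<^esub> \<omega> g1 (g2 \<otimes>\<^bsub>G\<^esub> g3) (inv\<^bsub>G\<^esub> g3) = \<zero>\<^bsub>R\<^esub> \<and>
        \<omega> g2 g3 g4 \<ominus>\<^bsub>R\<^esub> \<omega> (g1 \<otimes>\<^bsub>G\<^esub> g2) g3 g4 \<oplus>\<^bsub>R\<^esub> \<omega> g1 (g2 \<otimes>\<^bsub>G\<^esub> g3) g4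
          \<ominus>\<^bsub>R\<^esub> \<omega> g1 g2 (g3 \<otimes>\<^bsub>G\<^esub> g4) \<oplus>\<^bsub>R\<^esub> \<omega> g1 g2 g3 = \<zero>\<^bsub>R\<^esub>)"

text \<open>Over a commutative ring, tensors on copies of \<open>K\<close> and \<open>K\<^sup>*\<close> with a prescribed value on the
  standard generators exist, and so does the isomorphism \<open>K \<rightarrow> K\<^sup>*\<close> sending \<open>1\<close> to the identity.\<close>

lemma (in cring) tensor_on_generators_exists:
  fixes t
  defines "S \<equiv> self_module R" and "i \<equiv> (\<lambda>x\<in>carrier R. x)"
  assumes t: "t \<in> carrier R"
  shows "\<exists>\<phi>. \<phi> \<in> tensors R S (dual R S) S (dual R S) \<and> \<phi> \<one> i \<one> i = t"
    and "\<exists>\<phi>. \<phi> \<in> tensors R (dual R S) S (dual R S) S \<and> \<phi> i \<one> i \<one> = t"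
proof -
  let ?\<phi> = "\<lambda>x f y g. x \<otimes> (f \<one> \<otimes> (y \<otimes> (g \<one> \<otimes> t)))"
  let ?\<psi> = "\<lambda>f x g y. x \<otimes> (f \<one> \<otimes> (y \<otimes> (g \<one> \<otimes> t)))"
  have "?\<phi> \<in> tensors R S (dual R S) S (dual R S)" "?\<psi> \<in> tensors R (dual R S) S (dual R S) S"
    using t by (auto simp: S_def tensors_def linear_maps_def dual_def self_module_def
        l_distr r_distr Pi_def m_ac)
  moreover have "?\<phi> \<one> i \<one> i = t" "?\<psi> i \<one> i \<one> = t"
    using t by (simp_all add: i_def)
  ultimately show "\<exists>\<phi>. \<phi> \<in> tensors R S (dual R S) S (dual R S) \<and> \<phi> \<one> i \<one> i = t"
    and "\<exists>\<phi>. \<phi> \<in> tensors R (dual R S) S (dual R S) S \<and> \<phi> i \<one> i \<one> = t"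
    by blast+
qed

lemma (in cring) trivial_iso_exists:
  defines "S \<equiv> self_module R"
  shows "\<exists>h. h \<in> linear_isos R S (dual R S) \<and> h \<one> = (\<lambda>x\<in>carrier R. x)"
proof (intro exI conjI)
  let ?h = "\<lambda>r. \<lambda>x\<in>carrier R. r \<otimes> x"
  have eval: "f x = f \<one> \<otimes> x" if "f \<in> carrier (dual R S)" "x \<in> carrier R" for f x
  proof -
    have "f (x \<otimes> \<one>) = x \<otimes> f \<one>" "f \<one> \<in> carrier R"
      using that by (auto simp: S_def linear_maps_def dual_def self_module_def simp del: r_one)
    with that show ?thesis by (simp add: m_comm)
  qed
  have "?h \<in> linear_maps R S (dual R S)"
    by (auto simp: S_def linear_maps_def dual_def self_module_def l_distr r_distr Pi_def m_ac
        fun_eq_iff)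
  moreover have "bij_betw ?h (carrier S) (carrier (dual R S))"
  proof (rule bij_betw_byWitness[where f' = "\<lambda>f. f \<one>"])
    show "\<forall>f\<in>carrier (dual R S). ?h (f \<one>) = f"
    proof (intro ballI ext)
      fix f x assume f: "f \<in> carrier (dual R S)"
      then have "f \<in> extensional (carrier R)" by (simp add: S_def dual_def self_module_def)
      with eval[OF f, of x] show "?h (f \<one>) x = f x" by (simp add: extensional_def)
    qed
  qed (auto simp: S_def linear_maps_def dual_def self_module_def r_distr Pi_def m_ac)
  ultimately show "?h \<in> linear_isos R S (dual R S)" by (simp add: linear_isos_def)
qed auto

end

(* The identity generates K* and 1 generates K, so every tensor on copies of K and K* is the product
   of its arguments (evaluated at 1 where they are functionals) with its value on the generators.
   Contracting e \<otimes> f \<mapsto> e f(1) t over any basis gives t, because \<Sum>\<^sub>i e\<^sub>i e\<^sup>i(1) = 1.  Both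
   sides of every axiom then become products of values of \<theta>, and \<theta> turns the cocycle
   identities into the required equalities. *)
theory Submission
  imports Defs
begin

section \<open>The ring as a module over itself, and its dual\<close>

lemma self_module_simps [simp]:
  "carrier (self_module K) = carrier K" "add (self_module K) = add K"
  "zero (self_module K) = zero K" "smult (self_module K) = mult K"
  by (simp_all add: self_module_def)

text \<open>\<open>finsum\<close> reads only the carrier, addition and zero, which
  \<open>self_module K\<close> shares with \<open>K\<close>; basis expansions can thus be computed
  in the ring.\<close>

lemma finsum_self_module: "finsum (self_module K) f A = finsum K f A"
  by (simp add: finsum_def finprod_def)

context cring
begin

abbreviation S where "S \<equiv> self_module R"

lemma module_self_module: "module R S"
proof (intro moduleI abelian_groupI)
  show "cring R" by (rule is_cring)
  show "\<exists>y\<in>carrier S. y \<oplus>\<^bsub>S\<^esub> x = \<zero>\<^bsub>S\<^esub>" if "x \<in> carrier S" for x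
    using that l_neg by auto
qed (auto simp: a_ac m_ac l_distr r_distr)

lemma dual_self_module_closed:
  assumes "f \<in> carrier (dual R S)" "x \<in> carrier R" shows "f x \<in> carrier R"
  using assms by (auto simp: dual_def linear_maps_def)

lemma dual_self_module_eval:
  assumes "f \<in> carrier (dual R S)" "x \<in> carrier R" shows "f x = x \<otimes> f \<one>"
proof -
  \<comment> \<open>Linearity is applied to \<open>x\<close> written as \<open>x\<close> times the
    generator one; \<open>r_one\<close> would erase this form too early.\<close>
  have "f (x \<otimes> \<one>) = x \<otimes> f \<one>"
    using assms by (auto simp: dual_def linear_maps_def simp del: r_one)
  with assms show ?thesis by simp
qed

lemma id_in_dual: "(\<lambda>x\<in>carrier R. x) \<in> carrier (dual R S)"
  by (auto simp: dual_def linear_maps_def)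

text \<open>Commutativity turns \<open>x \<otimes> f \<one>\<close> into
  \<open>f \<one> \<otimes> x\<close>, so \<open>f \<one>\<close> is the coordinate of
  \<open>f\<close> with respect to the identity. Off the carrier both sides are
  \<open>undefined\<close>, because elements of the dual are extensional.\<close>

lemma dual_self_module_eq_smult_id:
  assumes "f \<in> carrier (dual R S)"
  shows "f = f \<one> \<odot>\<^bsub>dual R S\<^esub> (\<lambda>x\<in>carrier R. x)"
proof
  fix x
  have "f \<in> extensional (carrier R)" using assms by (simp add: dual_def)
  then show "f x = (f \<one> \<odot>\<^bsub>dual R S\<^esub> (\<lambda>x\<in>carrier R. x)) x"
    using dual_self_module_eval[OF assms, of x] dual_self_module_closed[OF assms, of \<one>]
    by (auto simp: dual_def extensional_def m_comm)
qed

section \<open>Linear maps and tensors are determined by their values on generators\<close>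

lemma linear_on_self_module:
  assumes "h \<in> linear_maps R S N" "x \<in> carrier R" shows "h x = x \<odot>\<^bsub>N\<^esub> h \<one>"
proof -
  have "h (x \<otimes> \<one>) = x \<odot>\<^bsub>N\<^esub> h \<one>"
    using assms by (auto simp: linear_maps_def simp del: r_one)
  with assms show ?thesis by simp
qed

lemma linear_on_dual_self_module:
  assumes "h \<in> linear_maps R (dual R S) N" "f \<in> carrier (dual R S)"
  shows "h f = f \<one> \<odot>\<^bsub>N\<^esub> h (\<lambda>x\<in>carrier R. x)"
proof -
  have "h (f \<one> \<odot>\<^bsub>dual R S\<^esub> (\<lambda>x\<in>carrier R. x)) = f \<one> \<odot>\<^bsub>N\<^esub> h (\<lambda>x\<in>carrier R. x)"
    using assms(1) id_in_dual dual_self_module_closed[OF assms(2), of \<one>]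
    by (simp add: linear_maps_def)
  with dual_self_module_eq_smult_id[OF assms(2)] show ?thesis by simp
qed

text \<open>With the other three arguments fixed, a tensor is linear in the remaining one. The
  arguments are replaced by their generators from left to right, each leaving its scalar in front,
  which explains the nesting to the right.\<close>

lemma tensor_eval:
  assumes \<phi>: "\<phi> \<in> tensors R S (dual R S) S (dual R S)"
    and x: "x \<in> carrier R" "y \<in> carrier R"
    and f: "f \<in> carrier (dual R S)" "g \<in> carrier (dual R S)"
  shows "\<phi> x f y g = x \<otimes> (f \<one> \<otimes> (y \<otimes> (g \<one> \<otimes> \<phi> \<one> (\<lambda>x\<in>carrier R. x) \<one> (\<lambda>x\<in>carrier R. x))))"
proof -
  let ?i = "\<lambda>x\<in>carrier R. x"
  have "\<phi> x f y g = x \<otimes> \<phi> \<one> f y g"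
    using \<phi> x f linear_on_self_module[of "\<lambda>x. \<phi> x f y g" S x] by (simp add: tensors_def)
  moreover have "\<phi> \<one> f y g = f \<one> \<otimes> \<phi> \<one> ?i y g"
    using \<phi> x f linear_on_dual_self_module[of "\<lambda>f. \<phi> \<one> f y g" S f] by (simp add: tensors_def)
  moreover have "\<phi> \<one> ?i y g = y \<otimes> \<phi> \<one> ?i \<one> g"
    using \<phi> x f id_in_dual linear_on_self_module[of "\<lambda>y. \<phi> \<one> ?i y g" S y]
    by (simp add: tensors_def)
  moreover have "\<phi> \<one> ?i \<one> g = g \<one> \<otimes> \<phi> \<one> ?i \<one> ?i"
    using \<phi> x f id_in_dual linear_on_dual_self_module[of "\<lambda>g. \<phi> \<one> ?i \<one> g" S g]
    by (simp add: tensors_def)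
  ultimately show ?thesis by simp
qed

text \<open>The same reduction with the ring and its dual exchanged, as needed for the barred
  tensors.\<close>

lemma tensor_eval':
  assumes \<phi>: "\<phi> \<in> tensors R (dual R S) S (dual R S) S"
    and x: "x \<in> carrier R" "y \<in> carrier R"
    and f: "f \<in> carrier (dual R S)" "g \<in> carrier (dual R S)"
  shows "\<phi> f x g y = f \<one> \<otimes> (x \<otimes> (g \<one> \<otimes> (y \<otimes> \<phi> (\<lambda>x\<in>carrier R. x) \<one> (\<lambda>x\<in>carrier R. x) \<one>)))"
proof -
  let ?i = "\<lambda>x\<in>carrier R. x"
  have "\<phi> f x g y = f \<one> \<otimes> \<phi> ?i x g y"
    using \<phi> x f linear_on_dual_self_module[of "\<lambda>f. \<phi> f x g y" S f] by (simp add: tensors_def)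
  moreover have "\<phi> ?i x g y = x \<otimes> \<phi> ?i \<one> g y"
    using \<phi> x f id_in_dual linear_on_self_module[of "\<lambda>x. \<phi> ?i x g y" S x]
    by (simp add: tensors_def)
  moreover have "\<phi> ?i \<one> g y = g \<one> \<otimes> \<phi> ?i \<one> ?i y"
    using \<phi> x f id_in_dual linear_on_dual_self_module[of "\<lambda>g. \<phi> ?i \<one> g y" S g]
    by (simp add: tensors_def)
  moreover have "\<phi> ?i \<one> ?i y = y \<otimes> \<phi> ?i \<one> ?i \<one>"
    using \<phi> x f id_in_dual linear_on_self_module[of "\<lambda>y. \<phi> ?i \<one> ?i y" S y]
    by (simp add: tensors_def)
  ultimately show ?thesis by simp
qed

section \<open>Bases of the ring, dual vectors and contraction\<close>

lemma finite_basis_one: "finite_basis R S {\<one>}"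
  unfolding finite_basis_def
proof (intro conjI ballI)
  fix x assume x: "x \<in> carrier S"
  show "\<exists>!r. r \<in> {\<one>} \<rightarrow>\<^sub>E carrier R \<and> x = (\<Oplus>\<^bsub>S\<^esub>b\<in>{\<one>}. r b \<odot>\<^bsub>S\<^esub> b)"
  proof (rule ex1I[of _ "\<lambda>b\<in>{\<one>}. x"])
    show "(\<lambda>b\<in>{\<one>}. x) \<in> {\<one>} \<rightarrow>\<^sub>E carrier R \<and>
        x = (\<Oplus>\<^bsub>S\<^esub>b\<in>{\<one>}. (\<lambda>b\<in>{\<one>}. x) b \<odot>\<^bsub>S\<^esub> b)"
      using x by (auto simp: finsum_self_module)
  next
    fix r assume r: "r \<in> {\<one>} \<rightarrow>\<^sub>E carrier R \<and> x = (\<Oplus>\<^bsub>S\<^esub>b\<in>{\<one>}. r b \<odot>\<^bsub>S\<^esub> b)"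
    then have "r \<one> \<in> carrier R" by auto
    with r have "x = r \<one>" by (simp add: finsum_self_module)
    with r show "r = (\<lambda>b\<in>{\<one>}. x)"
      by (auto simp: fun_eq_iff PiE_def extensional_def)
  qed
qed auto

lemma finsum_delta:
  assumes "finite B" "e \<in> B" "h \<in> B \<rightarrow> carrier R"
  shows "(\<Oplus>b\<in>B. h b \<otimes> (if b = e then \<one> else \<zero>)) = h e"
proof -
  \<comment> \<open>The condition is turned round to \<open>e = b\<close>, the form used by
    \<open>finsum_singleton\<close>.\<close>
  have "(\<Oplus>b\<in>B. h b \<otimes> (if b = e then \<one> else \<zero>)) = (\<Oplus>b\<in>B. if e = b then h b else \<zero>)"
    using assms by (intro finsum_cong') (auto simp: Pi_def)
  also have "\<dots> = h e" using assms by (intro finsum_singleton) auto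
  finally show ?thesis .
qed

text \<open>The dual vector at \<open>e\<close> is the coordinate function along \<open>e\<close>.
  Its value at one is therefore the coordinate of one, and these coordinates expand one. The basis
  is arbitrary because \<open>contract\<close> selects one by \<open>SOME\<close>.\<close>

lemma dual_vector_self_module:
  assumes B: "finite_basis R S B"
  obtains c where "c \<in> B \<rightarrow> carrier R" "(\<Oplus>b\<in>B. c b \<otimes> b) = \<one>"
    and "\<And>e. e \<in> B \<Longrightarrow> dual_vector R S B e \<in> carrier (dual R S)"
    and "\<And>e. e \<in> B \<Longrightarrow> dual_vector R S B e \<one> = c e"
proof -
  have fin: "finite B" and sub: "B \<subseteq> carrier R"
    and ex1: "\<And>x. x \<in> carrier R \<Longrightarrow> \<exists>!r. r \<in> B \<rightarrow>\<^sub>E carrier R \<and> x = (\<Oplus>b\<in>B. r b \<otimes> b)"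
    using B by (auto simp: finite_basis_def finsum_self_module)
  \<comment> \<open>\<open>c x\<close> is the coordinate family of \<open>x\<close> in
    \<open>B\<close>.\<close>
  obtain c where c: "\<And>x. x \<in> carrier R \<Longrightarrow> c x \<in> B \<rightarrow>\<^sub>E carrier R"
    and sum: "\<And>x. x \<in> carrier R \<Longrightarrow> (\<Oplus>b\<in>B. c x b \<otimes> b) = x"
    using ex1 by metis
  have cc: "c x b \<in> carrier R" if "x \<in> carrier R" "b \<in> B" for x b
    using c that by auto
  \<comment> \<open>The basis property compares extensional families only; restricting
    \<open>r\<close> to \<open>B\<close> makes uniqueness available for every family with values in
    the ring.\<close>
  have uniq: "c x e = r e"
    if "x \<in> carrier R" "r \<in> B \<rightarrow> carrier R" "(\<Oplus>b\<in>B. r b \<otimes> b) = x" "e \<in> B" for x r e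
  proof -
    have "(\<Oplus>b\<in>B. restrict r B b \<otimes> b) = (\<Oplus>b\<in>B. r b \<otimes> b)"
      using that sub by (intro finsum_cong') (auto simp: Pi_def)
    moreover have "restrict r B \<in> B \<rightarrow>\<^sub>E carrier R" using that(2) by auto
    ultimately have "c x = restrict r B"
      using ex1[OF that(1)] c[OF that(1)] sum[OF that(1)] that(3) by auto
    with that show ?thesis by simp
  qed
  \<comment> \<open>The coordinate function is linear, since sums and multiples of coordinate
    families expand the corresponding vectors and coordinates are unique. To identify it with the
    \<open>THE\<close> term, its values on \<open>B\<close> and the uniqueness of a functional with
    these values are shown.\<close>
  have dv: "dual_vector R S B e = (\<lambda>x\<in>carrier R. c x e)"
    and dvc: "(\<lambda>x\<in>carrier R. c x e) \<in> carrier (dual R S)" if e: "e \<in> B" for e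
  proof -
    have add: "c (x \<oplus> y) e = c x e \<oplus> c y e" if "x \<in> carrier R" "y \<in> carrier R" for x y
    proof (rule uniq[OF _ _ _ e])
      have "(\<Oplus>b\<in>B. (c x b \<oplus> c y b) \<otimes> b) = (\<Oplus>b\<in>B. c x b \<otimes> b \<oplus> c y b \<otimes> b)"
        using that sub cc by (intro finsum_cong') (auto simp: l_distr Pi_def subset_iff)
      also have "\<dots> = (\<Oplus>b\<in>B. c x b \<otimes> b) \<oplus> (\<Oplus>b\<in>B. c y b \<otimes> b)"
        using that sub cc by (intro finsum_addf) (auto simp: Pi_def subset_iff)
      finally show "(\<Oplus>b\<in>B. (c x b \<oplus> c y b) \<otimes> b) = x \<oplus> y" using sum that by simp
    qed (use that cc in auto)
    have smult: "c (r \<otimes> x) e = r \<otimes> c x e" if "r \<in> carrier R" "x \<in> carrier R" for r x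
    proof (rule uniq[OF _ _ _ e])
      have "(\<Oplus>b\<in>B. (r \<otimes> c x b) \<otimes> b) = (\<Oplus>b\<in>B. r \<otimes> (c x b \<otimes> b))"
        using that sub cc by (intro finsum_cong') (auto simp: m_assoc Pi_def subset_iff)
      also have "\<dots> = r \<otimes> (\<Oplus>b\<in>B. c x b \<otimes> b)"
        using that sub cc fin
        by (intro finsum_rdistr[symmetric]) (auto simp: Pi_def subset_iff)
      finally show "(\<Oplus>b\<in>B. (r \<otimes> c x b) \<otimes> b) = r \<otimes> x" using sum that by simp
    qed (use that cc in auto)
    show dvc: "(\<lambda>x\<in>carrier R. c x e) \<in> carrier (dual R S)"
      using add smult cc e by (auto simp: dual_def linear_maps_def)
    \<comment> \<open>The Kronecker family at \<open>b\<close> expands \<open>b\<close>, so by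
      uniqueness it is the coordinate family of \<open>b\<close>.\<close>
    have delta: "c b e = (if b = e then \<one> else \<zero>)" if b: "b \<in> B" for b
    proof (rule uniq[OF _ _ _ e, of b "\<lambda>d. if b = d then \<one> else \<zero>"])
      have "(\<Oplus>d\<in>B. (if b = d then \<one> else \<zero>) \<otimes> d) = (\<Oplus>d\<in>B. d \<otimes> (if d = b then \<one> else \<zero>))"
        using sub by (intro finsum_cong') (auto simp: Pi_def subset_iff)
      then show "(\<Oplus>d\<in>B. (if b = d then \<one> else \<zero>) \<otimes> d) = b"
        using finsum_delta[OF fin b, of "\<lambda>d. d"] sub by auto
    qed (use sub b in auto)
    show "dual_vector R S B e = (\<lambda>x\<in>carrier R. c x e)"
      unfolding dual_vector_def
    proof (rule the_equality)
      show "(\<lambda>x\<in>carrier R. c x e) \<in> carrier (dual R S) \<and>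
          (\<forall>b\<in>B. (\<lambda>x\<in>carrier R. c x e) b = (if b = e then \<one> else \<zero>))"
        using dvc delta sub by (auto simp: subset_iff)
    next
      fix f assume f: "f \<in> carrier (dual R S) \<and> (\<forall>b\<in>B. f b = (if b = e then \<one> else \<zero>))"
      show "f = (\<lambda>x\<in>carrier R. c x e)"
      proof
        fix x
        show "f x = (\<lambda>x\<in>carrier R. c x e) x"
        proof (cases "x \<in> carrier R")
          case True
          have f1: "f \<one> \<in> carrier R" using f dual_self_module_closed by blast
          \<comment> \<open>A functional is multiplication by \<open>f \<one>\<close>. Distributing
            this factor over the expansion of \<open>x\<close> turns each
            \<open>b \<otimes> f \<one>\<close> into \<open>f b\<close>, whose value is prescribed,
            and only the coordinate at \<open>e\<close> survives.\<close>
          have "f x = (\<Oplus>b\<in>B. c x b \<otimes> b) \<otimes> f \<one>"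
            using f dual_self_module_eval True sum by simp
          also have "\<dots> = (\<Oplus>b\<in>B. c x b \<otimes> b \<otimes> f \<one>)"
            using True sub cc fin f1 by (intro finsum_ldistr) (auto simp: Pi_def subset_iff)
          also have "\<dots> = (\<Oplus>b\<in>B. c x b \<otimes> (if b = e then \<one> else \<zero>))"
          proof (rule finsum_cong')
            fix b assume b: "b \<in> B"
            then have "b \<otimes> f \<one> = (if b = e then \<one> else \<zero>)"
              using f sub dual_self_module_eval[of f b] by auto
            then show "c x b \<otimes> b \<otimes> f \<one> = c x b \<otimes> (if b = e then \<one> else \<zero>)"
              using b sub cc True f1 by (auto simp: m_assoc subset_iff)
          qed (use True cc in auto)
          also have "\<dots> = c x e"
            using finsum_delta[OF fin e, of "c x"] cc True by auto
          finally show ?thesis using True by simp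
        next
          case False
          with f show ?thesis by (auto simp: dual_def extensional_def)
        qed
      qed
    qed
  qed
  show ?thesis
    by (rule that[of "c \<one>"]) (use dv dvc cc sum in auto)
qed

text \<open>The factor \<open>t\<close> comes out of the sum, and what remains is the expansion of
  one in the chosen basis. The condition on \<open>F\<close> is confined to the carriers, where all
  basis elements and dual vectors lie; its form lets the rule be iterated on nested
  contractions.\<close>

lemma contract_self_module:
  assumes t: "t \<in> carrier R"
    and F: "\<And>x f. \<lbrakk>x \<in> carrier R; f \<in> carrier (dual R S)\<rbrakk> \<Longrightarrow> F x f = x \<otimes> (f \<one> \<otimes> t)"
  shows "contract R S F = t"
proof -
  define B where "B = (SOME B. finite_basis R S B)"
  \<comment> \<open>The basis consisting of one alone guarantees that the choice in
    \<open>contract\<close> does return a basis.\<close>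
  have B: "finite_basis R S B"
    unfolding B_def using finite_basis_one by (rule someI)
  then have fin: "finite B" and sub: "B \<subseteq> carrier R" by (auto simp: finite_basis_def)
  obtain c where c: "c \<in> B \<rightarrow> carrier R" "(\<Oplus>b\<in>B. c b \<otimes> b) = \<one>"
    "\<And>e. e \<in> B \<Longrightarrow> dual_vector R S B e \<in> carrier (dual R S)"
    "\<And>e. e \<in> B \<Longrightarrow> dual_vector R S B e \<one> = c e"
    using dual_vector_self_module[OF B] by blast
  have "contract R S F = (\<Oplus>e\<in>B. F e (dual_vector R S B e))"
    by (simp add: contract_def B_def Let_def)
  also have "\<dots> = (\<Oplus>e\<in>B. c e \<otimes> e \<otimes> t)"
  proof (rule finsum_cong')
    fix e assume e: "e \<in> B"
    then have "e \<in> carrier R" "c e \<in> carrier R" using sub c(1) by auto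
    then show "F e (dual_vector R S B e) = c e \<otimes> e \<otimes> t"
      using F[of e "dual_vector R S B e"] c(3,4)[OF e] t by (simp add: m_ac)
  qed (use sub c(1) t in auto)
  also have "\<dots> = (\<Oplus>e\<in>B. c e \<otimes> e) \<otimes> t"
    using fin sub c(1) t by (intro finsum_ldistr[symmetric]) auto
  finally show ?thesis using c(2) t by simp
qed

section \<open>The trivial isomorphism, its inverse, and commutativity\<close>

lemma linear_iso_eval_one:
  assumes "h \<in> linear_isos R S (dual R S)" "h \<one> = (\<lambda>x\<in>carrier R. x)" "x \<in> carrier R"
  shows "h x \<in> carrier (dual R S)" "h x \<one> = x"
proof -
  have h: "h \<in> linear_maps R S (dual R S)" using assms(1) by (simp add: linear_isos_def)
  then show "h x \<in> carrier (dual R S)" using assms(3) by (auto simp: linear_maps_def)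
  \<comment> \<open>By linearity \<open>h x\<close> is \<open>x\<close> times the identity
    functional.\<close>
  show "h x \<one> = x" using linear_on_self_module[OF h assms(3)] assms(2,3) by (simp add: dual_def)
qed

text \<open>Evaluation at one recovers the argument of \<open>h\<close>, hence it computes the
  inverse of the bijection.\<close>

lemma inv_linear_iso_eval:
  assumes "h \<in> linear_isos R S (dual R S)" "h \<one> = (\<lambda>x\<in>carrier R. x)"
    and f: "f \<in> carrier (dual R S)"
  shows "inv_into (carrier R) h f = f \<one>"
proof -
  have bij: "bij_betw h (carrier R) (carrier (dual R S))"
    using assms(1) by (simp add: linear_isos_def)
  let ?x = "inv_into (carrier R) h f"
  have "?x \<in> carrier R" "h ?x = f"
    using bij f by (auto simp: bij_betw_def inv_into_into f_inv_into_f)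
  with linear_iso_eval_one(2)[OF assms(1,2), of ?x] show ?thesis by simp
qed

end

text \<open>Linearity of \<open>h r = r id\<close> as a functional already forces \<open>r s = s r\<close>.\<close>

lemma (in ring) cring_if_linear_iso_dual:
  assumes h: "h \<in> linear_maps R (self_module R) (dual R (self_module R))"
    and one: "h \<one> = (\<lambda>x\<in>carrier R. x)"
  shows "cring R"
proof (rule cring.intro[OF ring_axioms], unfold_locales)
  fix r s assume r: "r \<in> carrier R" and s: "s \<in> carrier R"
  have "h (r \<otimes> \<one>) = r \<odot>\<^bsub>dual R (self_module R)\<^esub> h \<one>"
    using h r by (auto simp: linear_maps_def simp del: r_one)
  then have eval: "h r x = r \<otimes> x" if "x \<in> carrier R" for x
    using that r one by (simp add: dual_def)
  have "h r \<in> carrier (dual R (self_module R))" using h r by (auto simp: linear_maps_def)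
  \<comment> \<open>Second evaluation of \<open>h r\<close> at \<open>s\<close>: linearity in the
    argument puts \<open>s\<close> on the left, whereas \<open>eval\<close> puts it on the
    right.\<close>
  then have "h r (s \<otimes> \<one>) = s \<otimes> h r \<one>"
    using s by (auto simp: dual_def linear_maps_def simp del: r_one)
  then show "r \<otimes> s = s \<otimes> r" using eval r s by simp
qed

section \<open>The special G-system of a 3-cocycle\<close>

theorem mainTheorem2:
  fixes G :: "('g, 'n) monoid_scheme"
    and R :: "('r, 'p) ring_scheme"
    and K :: "('k, 'm) ring_scheme"
    and \<omega> :: "'g \<Rightarrow> 'g \<Rightarrow> 'g \<Rightarrow> 'r"
    and \<theta> :: "'r \<Rightarrow> 'k"
    and \<I> :: "'g \<Rightarrow> 'g \<Rightarrow> 'g \<Rightarrow> 'k \<Rightarrow> ('k \<Rightarrow> 'k)"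
    and br :: "'g \<Rightarrow> 'g \<Rightarrow> 'g \<Rightarrow> 'k \<Rightarrow> ('k \<Rightarrow> 'k) \<Rightarrow> 'k \<Rightarrow> ('k \<Rightarrow> 'k) \<Rightarrow> 'k"
    and brb :: "'g \<Rightarrow> 'g \<Rightarrow> 'g \<Rightarrow> ('k \<Rightarrow> 'k) \<Rightarrow> 'k \<Rightarrow> ('k \<Rightarrow> 'k) \<Rightarrow> 'k \<Rightarrow> 'k"
  assumes "group G" and "finite (carrier G)"
    and "ring R" and "cocycle3 G R \<omega>"
    and "ring K" and "\<theta> \<in> iso (add_monoid R) (units_of K)"
    and "\<And>a b c. \<lbrakk>a \<in> carrier G; b \<in> carrier G; c \<in> carrier G; a \<otimes>\<^bsub>G\<^esub> b \<otimes>\<^bsub>G\<^esub> c = \<one>\<^bsub>G\<^esub>\<rbrakk> \<Longrightarrow>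
      \<I> a b c \<in> linear_isos K (self_module K) (dual K (self_module K)) \<and>
      \<I> a b c \<one>\<^bsub>K\<^esub> = (\<lambda>x\<in>carrier K. x)"
    and "\<And>a b c. \<lbrakk>a \<in> carrier G; b \<in> carrier G; c \<in> carrier G\<rbrakk> \<Longrightarrow>
      br a b c \<in> tensors K (self_module K) (dual K (self_module K))
        (self_module K) (dual K (self_module K)) \<and>
      br a b c \<one>\<^bsub>K\<^esub> (\<lambda>x\<in>carrier K. x) \<one>\<^bsub>K\<^esub> (\<lambda>x\<in>carrier K. x) = \<theta> (\<omega> a b c)"
    and "\<And>a b c. \<lbrakk>a \<in> carrier G; b \<in> carrier G; c \<in> carrier G\<rbrakk> \<Longrightarrow>
      brb a b c \<in> tensors K (dual K (self_module K)) (self_module K)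
        (dual K (self_module K)) (self_module K) \<and>
      brb a b c (\<lambda>x\<in>carrier K. x) \<one>\<^bsub>K\<^esub> (\<lambda>x\<in>carrier K. x) \<one>\<^bsub>K\<^esub> = \<theta> (\<ominus>\<^bsub>R\<^esub> \<omega> a b c)"
  shows "special_G_system G K (\<lambda>a b c. self_module K) \<I> br brb"
proof -
  interpret G: group G by fact
  interpret A: ring R by fact
  interpret K: ring K by fact
  note \<I> = assms(7) and br = assms(8) and brb = assms(9)
  \<comment> \<open>The identity triple has product one, so a trivial isomorphism is at hand. It
    forces \<open>K\<close> to be commutative, as the \<open>module\<close> locale and the
    evaluation lemmas require.\<close>
  have "\<I> \<one>\<^bsub>G\<^esub> \<one>\<^bsub>G\<^esub> \<one>\<^bsub>G\<^esub> \<in> linear_isos K (self_module K) (dual K (self_module K)) \<and>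
      \<I> \<one>\<^bsub>G\<^esub> \<one>\<^bsub>G\<^esub> \<one>\<^bsub>G\<^esub> \<one>\<^bsub>K\<^esub> = (\<lambda>x\<in>carrier K. x)"
    by (rule \<I>) auto
  then interpret K: cring K
    using K.cring_if_linear_iso_dual by (auto simp: linear_isos_def)
  let ?S = "self_module K" and ?D = "dual K (self_module K)"
  have \<omega>: "\<omega> a b c \<in> carrier R" if "a \<in> carrier G" "b \<in> carrier G" "c \<in> carrier G" for a b c
    using assms(4) that by (simp add: cocycle3_def)
  have \<theta>_units: "\<theta> r \<in> Units K" if "r \<in> carrier R" for r
    using assms(6) that by (auto simp: iso_def hom_def units_of_def)
  then have \<theta>: "\<theta> r \<in> carrier K" if "r \<in> carrier R" for r
    using that K.Units_closed by blast
  have \<theta>_add: "\<theta> (r \<oplus>\<^bsub>R\<^esub> s) = \<theta> r \<otimes>\<^bsub>K\<^esub> \<theta> s" if "r \<in> carrier R" "s \<in> carrier R" for r s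
    using assms(6) that by (simp add: iso_def hom_def units_of_def)
  have neg: "\<ominus>\<^bsub>R\<^esub> s = r" if "r \<oplus>\<^bsub>R\<^esub> s = \<zero>\<^bsub>R\<^esub>" "r \<in> carrier R" "s \<in> carrier R" for r s
    using A.minus_equality that by blast
  have \<I>_eval: "\<I> a b c x \<in> carrier ?D" "\<I> a b c x \<one>\<^bsub>K\<^esub> = x"
    if "a \<in> carrier G" "b \<in> carrier G" "c \<in> carrier G" "a \<otimes>\<^bsub>G\<^esub> b \<otimes>\<^bsub>G\<^esub> c = \<one>\<^bsub>G\<^esub>"
      "x \<in> carrier K" for a b c x
    using K.linear_iso_eval_one[of "\<I> a b c" x] \<I>[OF that(1-4)] that(5) by auto
  have \<I>_inv: "inv_into (carrier K) (\<I> a b c) f = f \<one>\<^bsub>K\<^esub>"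
    if "a \<in> carrier G" "b \<in> carrier G" "c \<in> carrier G" "a \<otimes>\<^bsub>G\<^esub> b \<otimes>\<^bsub>G\<^esub> c = \<one>\<^bsub>G\<^esub>"
      "f \<in> carrier ?D" for a b c f
    using K.inv_linear_iso_eval[of "\<I> a b c" f] \<I>[OF that(1-4)] that(5) by auto
  have br_eval: "br a b c x f y g =
      x \<otimes>\<^bsub>K\<^esub> (f \<one>\<^bsub>K\<^esub> \<otimes>\<^bsub>K\<^esub> (y \<otimes>\<^bsub>K\<^esub> (g \<one>\<^bsub>K\<^esub> \<otimes>\<^bsub>K\<^esub> \<theta> (\<omega> a b c))))"
    if "a \<in> carrier G" "b \<in> carrier G" "c \<in> carrier G"
      "x \<in> carrier K" "y \<in> carrier K" "f \<in> carrier ?D" "g \<in> carrier ?D" for a b c x f y g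
    using K.tensor_eval[of "br a b c" x y f g] br[OF that(1-3)] that(4-7) by simp
  have brb_eval: "brb a b c f x g y =
      f \<one>\<^bsub>K\<^esub> \<otimes>\<^bsub>K\<^esub> (x \<otimes>\<^bsub>K\<^esub> (g \<one>\<^bsub>K\<^esub> \<otimes>\<^bsub>K\<^esub> (y \<otimes>\<^bsub>K\<^esub> \<theta> (\<ominus>\<^bsub>R\<^esub> \<omega> a b c))))"
    if "a \<in> carrier G" "b \<in> carrier G" "c \<in> carrier G"
      "x \<in> carrier K" "y \<in> carrier K" "f \<in> carrier ?D" "g \<in> carrier ?D" for a b c x f y g
    using K.tensor_eval'[of "brb a b c" x y f g] brb[OF that(1-3)] that(4-7) by simp
  \<comment> \<open>The four-variable cocycle identity with its negative terms moved to the other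
    side, carried by \<theta> from sums to products.\<close>
  have cocycle: "\<theta> (\<omega> (a \<otimes>\<^bsub>G\<^esub> b) c d) \<otimes>\<^bsub>K\<^esub> \<theta> (\<omega> a b (c \<otimes>\<^bsub>G\<^esub> d)) =
      \<theta> (\<omega> b c d) \<otimes>\<^bsub>K\<^esub> \<theta> (\<omega> a (b \<otimes>\<^bsub>G\<^esub> c) d) \<otimes>\<^bsub>K\<^esub> \<theta> (\<omega> a b c)"
    if "a \<in> carrier G" "b \<in> carrier G" "c \<in> carrier G" "d \<in> carrier G" for a b c d
  proof -
    let ?p = "\<omega> (a \<otimes>\<^bsub>G\<^esub> b) c d" and ?q = "\<omega> a b (c \<otimes>\<^bsub>G\<^esub> d)"
    let ?r = "\<omega> b c d" and ?s = "\<omega> a (b \<otimes>\<^bsub>G\<^esub> c) d" and ?t = "\<omega> a b c"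
    have mem: "?p \<in> carrier R" "?q \<in> carrier R" "?r \<in> carrier R" "?s \<in> carrier R" "?t \<in> carrier R"
      using \<omega> that by auto
    have "?r \<ominus>\<^bsub>R\<^esub> ?p \<oplus>\<^bsub>R\<^esub> ?s \<ominus>\<^bsub>R\<^esub> ?q \<oplus>\<^bsub>R\<^esub> ?t = \<zero>\<^bsub>R\<^esub>"
      using assms(4) that by (simp add: cocycle3_def)
    then have "(?r \<oplus>\<^bsub>R\<^esub> ?s \<oplus>\<^bsub>R\<^esub> ?t) \<ominus>\<^bsub>R\<^esub> (?p \<oplus>\<^bsub>R\<^esub> ?q) = \<zero>\<^bsub>R\<^esub>"
      using mem by (simp add: a_minus_def A.minus_add A.a_ac)
    then have "?p \<oplus>\<^bsub>R\<^esub> ?q = ?r \<oplus>\<^bsub>R\<^esub> ?s \<oplus>\<^bsub>R\<^esub> ?t"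
      using mem A.minus_equality[of "?r \<oplus>\<^bsub>R\<^esub> ?s \<oplus>\<^bsub>R\<^esub> ?t" "\<ominus>\<^bsub>R\<^esub> (?p \<oplus>\<^bsub>R\<^esub> ?q)"]
      by (simp add: a_minus_def)
    then show ?thesis using \<theta>_add mem by (metis A.add.m_closed)
  qed
  \<comment> \<open>Each of the other three cocycle identities makes \<omega> at the transformed
    triple the negative of \<omega> at \<open>(a, b, c)\<close>. The sign in the barred value
    cancels this one.\<close>
  have cocycle_symmetry:
    "\<theta> (\<ominus>\<^bsub>R\<^esub> \<omega> (inv\<^bsub>G\<^esub> a) (a \<otimes>\<^bsub>G\<^esub> b) c) = \<theta> (\<omega> a b c)"
    "\<theta> (\<ominus>\<^bsub>R\<^esub> \<omega> (a \<otimes>\<^bsub>G\<^esub> b) (inv\<^bsub>G\<^esub> b) (b \<otimes>\<^bsub>G\<^esub> c)) = \<theta> (\<omega> a b c)"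
    "\<theta> (\<ominus>\<^bsub>R\<^esub> \<omega> a (b \<otimes>\<^bsub>G\<^esub> c) (inv\<^bsub>G\<^esub> c)) = \<theta> (\<omega> a b c)"
    if "a \<in> carrier G" "b \<in> carrier G" "c \<in> carrier G" for a b c
    using assms(4) that \<omega> by (auto simp: cocycle3_def intro!: arg_cong[of _ _ \<theta>] neg)
  \<comment> \<open>Used by the simplifier to check that the index triples in the second and third
    symmetries have product one.\<close>
  have cancel: "x \<otimes>\<^bsub>G\<^esub> y \<otimes>\<^bsub>G\<^esub> inv\<^bsub>G\<^esub> y = x" if "x \<in> carrier G" "y \<in> carrier G" for x y
    using that by (simp add: G.m_assoc)
  show ?thesis
  proof (intro special_G_system.intro G_system.intro G_data.intro G_system_axioms.intro
      special_G_system_axioms.intro)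
    show "group G" "ring K" by fact+
  next
    show "module K ?S" by (rule K.module_self_module)
    show "\<exists>B. finite_basis K ?S B" using K.finite_basis_one by blast
    show "?S = ?S \<and> ?S = ?S" by simp
  next
    fix a b c assume G: "a \<in> carrier G" "b \<in> carrier G" "c \<in> carrier G"
    show "br a b c \<in> tensors K ?S ?D ?S ?D" "brb a b c \<in> tensors K ?D ?S ?D ?S"
      using br brb G by blast+
    show "\<I> a b c \<in> linear_isos K ?S ?D" if "a \<otimes>\<^bsub>G\<^esub> b \<otimes>\<^bsub>G\<^esub> c = \<one>\<^bsub>G\<^esub>"
      using \<I> G that by blast
    fix x0 x1 x2 x3
    {
      assume x: "x0 \<in> carrier ?D" "x1 \<in> carrier ?S" "x2 \<in> carrier ?D" "x3 \<in> carrier ?S"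
      have "a \<otimes>\<^bsub>G\<^esub> (b \<otimes>\<^bsub>G\<^esub> c) \<otimes>\<^bsub>G\<^esub> inv\<^bsub>G\<^esub> (a \<otimes>\<^bsub>G\<^esub> b \<otimes>\<^bsub>G\<^esub> c) = \<one>\<^bsub>G\<^esub>"
        "inv\<^bsub>G\<^esub> a \<otimes>\<^bsub>G\<^esub> (a \<otimes>\<^bsub>G\<^esub> b) \<otimes>\<^bsub>G\<^esub> inv\<^bsub>G\<^esub> b = \<one>\<^bsub>G\<^esub>"
        using G by (simp_all add: G.m_assoc[symmetric])
      \<comment> \<open>Both sides evaluate to the same scalars times a value of \<theta>: the
        isomorphism and its inverse only exchange a scalar with the functional having that value at
        one. \<open>cocycle_symmetry\<close> matches the values of \<theta>, and commutativity the
        order. The next two cases work alike.\<close>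
      then show "brb (inv\<^bsub>G\<^esub> a) (a \<otimes>\<^bsub>G\<^esub> b) c x0 x1 x2 x3 = br a b c x1 x0
          (inv_into (carrier ?S) (\<I> a (b \<otimes>\<^bsub>G\<^esub> c) (inv\<^bsub>G\<^esub> (a \<otimes>\<^bsub>G\<^esub> b \<otimes>\<^bsub>G\<^esub> c))) x2)
          (\<I> (inv\<^bsub>G\<^esub> a) (a \<otimes>\<^bsub>G\<^esub> b) (inv\<^bsub>G\<^esub> b) x3)"
        using G x \<theta> \<omega> K.dual_self_module_closed
        by (simp add: brb_eval br_eval \<I>_eval \<I>_inv cocycle_symmetry K.m_ac)
    next
      assume x: "x0 \<in> carrier ?D" "x1 \<in> carrier ?S" "x2 \<in> carrier ?D" "x3 \<in> carrier ?S"
      show "brb (a \<otimes>\<^bsub>G\<^esub> b) (inv\<^bsub>G\<^esub> b) (b \<otimes>\<^bsub>G\<^esub> c) x0 x1 x2 x3 = br a b c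
          (inv_into (carrier ?S) (\<I> b c (inv\<^bsub>G\<^esub> (b \<otimes>\<^bsub>G\<^esub> c))) x0) x2 x1
          (\<I> (a \<otimes>\<^bsub>G\<^esub> b) (inv\<^bsub>G\<^esub> b) (inv\<^bsub>G\<^esub> a) x3)"
        using G x \<theta> \<omega> K.dual_self_module_closed
        by (simp add: brb_eval br_eval \<I>_eval \<I>_inv cocycle_symmetry cancel K.m_ac)
    next
      assume x: "x0 \<in> carrier ?D" "x1 \<in> carrier ?S" "x2 \<in> carrier ?D" "x3 \<in> carrier ?S"
      show "brb a (b \<otimes>\<^bsub>G\<^esub> c) (inv\<^bsub>G\<^esub> c) x0 x1 x2 x3 = br a b c
          (inv_into (carrier ?S) (\<I> b c (inv\<^bsub>G\<^esub> (b \<otimes>\<^bsub>G\<^esub> c))) x0)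
          (\<I> (a \<otimes>\<^bsub>G\<^esub> b \<otimes>\<^bsub>G\<^esub> c) (inv\<^bsub>G\<^esub> c) (inv\<^bsub>G\<^esub> (a \<otimes>\<^bsub>G\<^esub> b)) x1) x3 x2"
        using G x \<theta> \<omega> K.dual_self_module_closed
        by (simp add: brb_eval br_eval \<I>_eval \<I>_inv cocycle_symmetry cancel K.m_ac)
    }
  next
    fix a b c d u1 u2 u3 u4 u5 u6
    assume G: "a \<in> carrier G" "b \<in> carrier G" "c \<in> carrier G" "d \<in> carrier G"
      and u: "u1 \<in> carrier ?S" "u2 \<in> carrier ?S" "u3 \<in> carrier ?D"
        "u4 \<in> carrier ?S" "u5 \<in> carrier ?D" "u6 \<in> carrier ?D"
    let ?p = "\<theta> (\<omega> (a \<otimes>\<^bsub>G\<^esub> b) c d)" and ?q = "\<theta> (\<omega> a b (c \<otimes>\<^bsub>G\<^esub> d))"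
    let ?r = "\<theta> (\<omega> b c d)" and ?s = "\<theta> (\<omega> a (b \<otimes>\<^bsub>G\<^esub> c) d)" and ?t = "\<theta> (\<omega> a b c)"
    \<comment> \<open>\<open>?U\<close> collects the six arguments that are not contracted; it is
      the common factor of both sides.\<close>
    let ?U = "u1 \<otimes>\<^bsub>K\<^esub> u2 \<otimes>\<^bsub>K\<^esub> u3 \<one>\<^bsub>K\<^esub> \<otimes>\<^bsub>K\<^esub> u4 \<otimes>\<^bsub>K\<^esub> u5 \<one>\<^bsub>K\<^esub> \<otimes>\<^bsub>K\<^esub> u6 \<one>\<^bsub>K\<^esub>"
    have mem: "?p \<in> carrier K" "?q \<in> carrier K" "?r \<in> carrier K" "?s \<in> carrier K" "?t \<in> carrier K"
      "u1 \<in> carrier K" "u2 \<in> carrier K" "u3 \<one>\<^bsub>K\<^esub> \<in> carrier K"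
      "u4 \<in> carrier K" "u5 \<one>\<^bsub>K\<^esub> \<in> carrier K" "u6 \<one>\<^bsub>K\<^esub> \<in> carrier K"
      using G u \<theta> \<omega> K.dual_self_module_closed by auto
    have "contract K ?S (\<lambda>e e'. br (a \<otimes>\<^bsub>G\<^esub> b) c d u4 u5 e u6 \<otimes>\<^bsub>K\<^esub>
        br a b (c \<otimes>\<^bsub>G\<^esub> d) u1 e' u2 u3) = ?U \<otimes>\<^bsub>K\<^esub> (?p \<otimes>\<^bsub>K\<^esub> ?q)"
      by (rule K.contract_self_module)
        (use G u mem K.dual_self_module_closed in \<open>simp_all add: br_eval K.m_ac\<close>)
    also have "\<dots> = ?U \<otimes>\<^bsub>K\<^esub> (?r \<otimes>\<^bsub>K\<^esub> ?s \<otimes>\<^bsub>K\<^esub> ?t)"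
      using cocycle G by simp
    also have "\<dots> = contract K ?S (\<lambda>e e'. contract K ?S (\<lambda>f f'. contract K ?S (\<lambda>g g'.
        br b c d u4 f' u1 e' \<otimes>\<^bsub>K\<^esub> br a (b \<otimes>\<^bsub>G\<^esub> c) d f u5 u2 g' \<otimes>\<^bsub>K\<^esub> br a b c e u6 g u3)))"
    \<comment> \<open>The rule is applied from the outermost contraction inwards. The product
      demanded by one level serves as \<open>t\<close> for the next, so the innermost pair
      \<open>g\<close>, \<open>g'\<close> ends up in front.\<close>
    proof (rule sym, intro K.contract_self_module)
      fix e e' f f' g g'
      assume efg: "e \<in> carrier K" "e' \<in> carrier ?D" "f \<in> carrier K" "f' \<in> carrier ?D"
        "g \<in> carrier K" "g' \<in> carrier ?D"
      then have "e' \<one>\<^bsub>K\<^esub> \<in> carrier K" "f' \<one>\<^bsub>K\<^esub> \<in> carrier K" "g' \<one>\<^bsub>K\<^esub> \<in> carrier K"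
        using K.dual_self_module_closed by auto
      then show "br b c d u4 f' u1 e' \<otimes>\<^bsub>K\<^esub> br a (b \<otimes>\<^bsub>G\<^esub> c) d f u5 u2 g' \<otimes>\<^bsub>K\<^esub> br a b c e u6 g u3 =
          g \<otimes>\<^bsub>K\<^esub> (g' \<one>\<^bsub>K\<^esub> \<otimes>\<^bsub>K\<^esub> (f \<otimes>\<^bsub>K\<^esub> (f' \<one>\<^bsub>K\<^esub> \<otimes>\<^bsub>K\<^esub>
            (e \<otimes>\<^bsub>K\<^esub> (e' \<one>\<^bsub>K\<^esub> \<otimes>\<^bsub>K\<^esub> (?U \<otimes>\<^bsub>K\<^esub> (?r \<otimes>\<^bsub>K\<^esub> ?s \<otimes>\<^bsub>K\<^esub> ?t)))))))"
        using G u mem efg by (simp add: br_eval K.m_ac)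
    qed (use mem K.dual_self_module_closed in simp_all)
    finally show "contract K ?S (\<lambda>e e'. br (a \<otimes>\<^bsub>G\<^esub> b) c d u4 u5 e u6 \<otimes>\<^bsub>K\<^esub>
        br a b (c \<otimes>\<^bsub>G\<^esub> d) u1 e' u2 u3) =
      contract K ?S (\<lambda>e e'. contract K ?S (\<lambda>f f'. contract K ?S (\<lambda>g g'.
        br b c d u4 f' u1 e' \<otimes>\<^bsub>K\<^esub> br a (b \<otimes>\<^bsub>G\<^esub> c) d f u5 u2 g' \<otimes>\<^bsub>K\<^esub> br a b c e u6 g u3)))" .
  qed
qed

end
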